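(* Let $\omega$ be a weight. The following statements are equivalent. (1) ($\omega\in A_\infty^{con}$) There exist $0<\gamma,\delta<1$ such that for all $n\in\mathbb{N}$, $\mathbb{E}(\chi_{\{\omega\le\gamma\omega_n\}}|\mathcal{F}_n)\le\delta<1$. (2) ($\omega\in A_\infty^{M}$) There exist $0<\alpha,\beta<1$ such that for all $n\in\mathbb{N}$ and $A\in\mathcal{F}$: $\mathbb{E}(\chi_A|\mathcal{F}_n)\le\alpha<1\Rightarrow\mathbb{E}_\omega(\chi_A|\mathcal{F}_n)\le\beta<1$.
   Context: $(\Omega,\mathcal{F},\mu)$ is a complete probability space and $(\mathcal{F}_n)_{n\ge0}$ is an increasing sequence of sub-$\sigma$-fields of $\mathcal{F}$ with $\mathcal{F}=\bigvee_{n\ge0}\mathcal{F}_n$. $\mathbb{N}$ is the set of non-negative integers. $\mathbb{E}(\cdot|\mathcal{F}_n)$ is conditional expectation with respect to $\mu$. Relations between random variables hold almost surely. A weight $\omega$ is a random variable with $\omega>0$ and $\mathbb{E}(\omega)<\infty$; $\omega_n:=\mathbb{E}(\omega|\mathcal{F}_n)$. $\mathbb{E}_\omega(\cdot|\mathcal{F}_n)$ is the conditional expectation with respect to $\omega\,d\mu$, i.e. $\mathbb{E}_\omega(f|\mathcal{F}_n)=\mathbb{E}(f\omega|\mathcal{F}_n)/\omega_n$. $\chi_A$ is the indicator function of $A$. *)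

theory Defs
  imports "HOL-Probability.Probability"
begin

text \<open>Positivity is almost sure, as are all relations between random variables below.\<close>

definition weight :: "'a measure \<Rightarrow> ('a \<Rightarrow> real) \<Rightarrow> bool" where
  "weight M w \<longleftrightarrow> integrable M w \<and> (AE x in M. 0 < w x)"

text \<open>The conditional expectation with respect to the measure \<open>\<omega> d\<mu>\<close>, which is finite but
  not normalised. The lemma \<open>weighted_cond_exp_eq\<close> below gives the quotient formula
  \<open>E(f \<omega> | G) / E(\<omega> | G)\<close> for it.\<close>

definition weighted_cond_exp ::
  "'a measure \<Rightarrow> ('a \<Rightarrow> real) \<Rightarrow> 'a measure \<Rightarrow> ('a \<Rightarrow> real) \<Rightarrow> 'a \<Rightarrow> real" where
  "weighted_cond_exp M w G f = real_cond_exp (density M (\<lambda>x. ennreal (w x))) G f"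

definition A_infinity_con :: "'a measure \<Rightarrow> (nat \<Rightarrow> 'a measure) \<Rightarrow> ('a \<Rightarrow> real) \<Rightarrow> bool" where
  "A_infinity_con M F w \<longleftrightarrow>
     (\<exists>\<gamma> \<delta> :: real. 0 < \<gamma> \<and> \<gamma> < 1 \<and> 0 < \<delta> \<and> \<delta> < 1 \<and>
        (\<forall>n. AE x in M.
           real_cond_exp M (F n)
             (indicator {y \<in> space M. w y \<le> \<gamma> * real_cond_exp M (F n) w y}) x \<le> \<delta>))"

text \<open>Both sides of the implication are almost sure relations on the whole space. The pointwise
  reading, where the implication itself holds almost surely, is equivalent with the same
  constants; see \<open>A_infinity_M_iff_pointwise\<close>.\<close>

definition A_infinity_M :: "'a measure \<Rightarrow> (nat \<Rightarrow> 'a measure) \<Rightarrow> ('a \<Rightarrow> real) \<Rightarrow> bool" where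
  "A_infinity_M M F w \<longleftrightarrow>
     (\<exists>\<alpha> \<beta> :: real. 0 < \<alpha> \<and> \<alpha> < 1 \<and> 0 < \<beta> \<and> \<beta> < 1 \<and>
        (\<forall>n. \<forall>A \<in> sets M.
           (AE x in M. real_cond_exp M (F n) (indicator A) x \<le> \<alpha>) \<longrightarrow>
           (AE x in M. weighted_cond_exp M w (F n) (indicator A) x \<le> \<beta>)))"

lemma AE_density_weight:
  assumes "weight M w"
  shows "(AE x in density M (\<lambda>x. ennreal (w x)). P x) \<longleftrightarrow> (AE x in M. P x)"
proof -
  have [measurable]: "w \<in> borel_measurable M" and pos: "AE x in M. 0 < w x"
    using assms by (auto simp: weight_def)
  have "(AE x in M. 0 < ennreal (w x) \<longrightarrow> P x) \<longleftrightarrow> (AE x in M. P x)"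
    using pos by (auto elim: eventually_elim2)
  then show ?thesis by (simp add: AE_density)
qed

lemma finite_measure_subalgebra_density_weight:
  assumes "weight M w" "subalgebra M G"
  shows "finite_measure_subalgebra (density M (\<lambda>x. ennreal (w x))) G"
proof -
  have [measurable]: "w \<in> borel_measurable M" and int: "integrable M w"
    using assms by (auto simp: weight_def)
  have "(\<integral>\<^sup>+x. ennreal (w x) \<partial>M) \<le> (\<integral>\<^sup>+x. ennreal (norm (w x)) \<partial>M)"
    by (intro nn_integral_mono) (auto simp: ennreal_leI)
  also have "\<dots> < \<infinity>" using int by (simp add: integrable_iff_bounded)
  finally have fin: "(\<integral>\<^sup>+x. ennreal (w x) \<partial>M) < \<infinity>" .
  have "emeasure (density M (\<lambda>x. ennreal (w x))) (space M) = (\<integral>\<^sup>+x. ennreal (w x) \<partial>M)"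
    by (subst emeasure_density) (auto intro!: nn_integral_cong)
  then have "finite_measure (density M (\<lambda>x. ennreal (w x)))"
    using fin by (intro finite_measureI) auto
  then show ?thesis
    using assms(2) by (auto simp: finite_measure_subalgebra_def finite_measure_subalgebra_axioms_def
      subalgebra_def)
qed

lemma weighted_cond_exp_eq:
  assumes "prob_space M" "weight M w" "subalgebra M G"
    and f[measurable]: "f \<in> borel_measurable M" and fw: "integrable M (\<lambda>x. f x * w x)"
  shows "AE x in M. weighted_cond_exp M w G f x =
    real_cond_exp M G (\<lambda>y. f y * w y) x / real_cond_exp M G w x"
proof -
  interpret prob_space M by fact
  interpret finite_measure_subalgebra M G
    by standard fact
  let ?N = "density M (\<lambda>x. ennreal (w x))"
  interpret N: finite_measure_subalgebra ?N G
    by (rule finite_measure_subalgebra_density_weight) fact+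
  have [measurable]: "w \<in> borel_measurable M" and int: "integrable M w"
    and pos: "AE x in M. 0 < w x" and nn: "AE x in M. 0 \<le> w x"
    using assms by (auto simp: weight_def elim: eventually_mono)
  have fN: "integrable ?N f"
    using fw nn by (subst integrable_density) (auto simp: mult.commute)
  have E: "weighted_cond_exp M w G f = real_cond_exp ?N G f" by (simp add: weighted_cond_exp_def)
  let ?g = "real_cond_exp ?N G f"
  have [measurable]: "?g \<in> borel_measurable G" "?g \<in> borel_measurable M"
    using borel_measurable_cond_exp2[of ?N G f] by auto
  have gN: "integrable ?N ?g" using fN by (rule N.real_cond_exp_int)
  have gw: "integrable M (\<lambda>x. ?g x * w x)"
    using gN nn by (subst (asm) integrable_density) (auto simp: mult.commute)
  have 1: "AE x in M. real_cond_exp M G (\<lambda>x. ?g x * w x) x = ?g x * real_cond_exp M G w x"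
    by (rule real_cond_exp_mult) (use gw in auto)
  have 2: "AE x in M. real_cond_exp M G (\<lambda>x. f x * w x) x = real_cond_exp M G (\<lambda>x. ?g x * w x) x"
  proof (rule real_cond_exp_charact)
    fix A assume A: "A \<in> sets G"
    have [measurable]: "A \<in> sets M" using A subalg by (auto simp: subalgebra_def)
    have key: "(\<integral>x\<in>A. h x * w x \<partial>M) = (\<integral>x\<in>A. h x \<partial>?N)"
      if [measurable]: "h \<in> borel_measurable M" for h
      unfolding set_lebesgue_integral_def
      by (subst integral_density) (use nn in \<open>auto simp: mult_ac\<close>)
    have "(\<integral>x\<in>A. f x * w x \<partial>M) = (\<integral>x\<in>A. ?g x * w x \<partial>M)"
      using N.real_cond_exp_intA[OF fN A] by (simp add: key)
    also have "\<dots> = (\<integral>x\<in>A. real_cond_exp M G (\<lambda>x. ?g x * w x) x \<partial>M)"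
      by (rule real_cond_exp_intA[OF gw A])
    finally show "(\<integral>x\<in>A. f x * w x \<partial>M) = (\<integral>x\<in>A. real_cond_exp M G (\<lambda>x. ?g x * w x) x \<partial>M)" .
  qed (use fw gw in \<open>auto intro: real_cond_exp_int\<close>)
  have 3: "AE x in M. 0 < real_cond_exp M G w x"
    by (rule real_cond_exp_gr_c[OF int pos])
  show ?thesis unfolding E using 1 2 3 by eventually_elim (auto simp: field_simps)
qed

lemma A_infinity_M_iff_pointwise:
  assumes "prob_space M" "weight M w" "\<And>n. subalgebra M (F n)"
  shows "A_infinity_M M F w \<longleftrightarrow>
     (\<exists>\<alpha> \<beta> :: real. 0 < \<alpha> \<and> \<alpha> < 1 \<and> 0 < \<beta> \<and> \<beta> < 1 \<and>
        (\<forall>n. \<forall>A \<in> sets M. AE x in M.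
           real_cond_exp M (F n) (indicator A) x \<le> \<alpha> \<longrightarrow>
           weighted_cond_exp M w (F n) (indicator A) x \<le> \<beta>))"
proof -
  interpret prob_space M by fact
  have "AE x in M. real_cond_exp M (F n) (indicator A) x \<le> \<alpha> \<longrightarrow>
           weighted_cond_exp M w (F n) (indicator A) x \<le> \<beta>"
    if "0 < \<alpha>" and A[measurable]: "A \<in> sets M" and imp: "\<And>A. A \<in> sets M \<Longrightarrow>
      (AE x in M. real_cond_exp M (F n) (indicator A) x \<le> \<alpha>) \<Longrightarrow>
      (AE x in M. weighted_cond_exp M w (F n) (indicator A) x \<le> \<beta>)" for \<alpha> \<beta> n A
  proof -
    interpret finite_measure_subalgebra M "F n"
      by standard fact
    let ?N = "density M (\<lambda>x. ennreal (w x))"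
    interpret N: finite_measure_subalgebra ?N "F n"
      by (rule finite_measure_subalgebra_density_weight) fact+
    define B where "B = {x \<in> space (F n). real_cond_exp M (F n) (indicator A) x \<le> \<alpha>}"
    have B[measurable]: "B \<in> sets (F n)" unfolding B_def by measurable
    have [measurable]: "B \<in> sets M" using B subalg by (auto simp: subalgebra_def)
    have sp: "space (F n) = space M" using subalg by (auto simp: subalgebra_def)
    have eq: "indicator (A \<inter> B) = (\<lambda>x. indicator B x * indicator A x :: real)"
      by (auto simp: indicator_def)
    have "A \<inter> B \<in> sets M" by measurable
    then have iM: "integrable M (\<lambda>x. indicator B x * indicator A x :: real)"
      and "integrable ?N (indicator (A \<inter> B) :: 'a \<Rightarrow> real)"
      unfolding eq[symmetric]
      by (auto intro!: integrable_real_indicator simp: less_top[symmetric] N.emeasure_finite)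
    then have iN: "integrable ?N (\<lambda>x. indicator B x * indicator A x :: real)"
      by (simp only: eq)
    have 1: "AE x in M. real_cond_exp M (F n) (indicator (A \<inter> B)) x =
        indicator B x * real_cond_exp M (F n) (indicator A) x"
      unfolding eq by (rule real_cond_exp_mult) (use iM in auto)
    have "AE x in ?N. real_cond_exp ?N (F n) (indicator (A \<inter> B)) x =
        indicator B x * real_cond_exp ?N (F n) (indicator A) x"
      unfolding eq by (rule N.real_cond_exp_mult) (use iN in auto)
    then have 2: "AE x in M. weighted_cond_exp M w (F n) (indicator (A \<inter> B)) x =
        indicator B x * weighted_cond_exp M w (F n) (indicator A) x"
      by (simp add: AE_density_weight[OF assms(2)] weighted_cond_exp_def)
    have "AE x in M. real_cond_exp M (F n) (indicator (A \<inter> B)) x \<le> \<alpha>"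
      using 1 by eventually_elim (use \<open>0 < \<alpha>\<close> in \<open>auto simp: B_def indicator_def\<close>)
    then have "AE x in M. weighted_cond_exp M w (F n) (indicator (A \<inter> B)) x \<le> \<beta>"
      by (intro imp) auto
    with 2 AE_space show ?thesis
      by eventually_elim (auto simp: B_def sp)
  qed
  note * = this
  have "(\<forall>n. \<forall>A \<in> sets M.
           (AE x in M. real_cond_exp M (F n) (indicator A) x \<le> \<alpha>) \<longrightarrow>
           (AE x in M. weighted_cond_exp M w (F n) (indicator A) x \<le> \<beta>)) \<longleftrightarrow>
        (\<forall>n. \<forall>A \<in> sets M. AE x in M.
           real_cond_exp M (F n) (indicator A) x \<le> \<alpha> \<longrightarrow>
           weighted_cond_exp M w (F n) (indicator A) x \<le> \<beta>)" (is "?L \<longleftrightarrow> ?R")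
    if "0 < \<alpha>" for \<alpha> \<beta> :: real
  proof
    assume L: ?L
    show ?R
    proof (intro allI ballI)
      fix n A assume "A \<in> sets M"
      with \<open>0 < \<alpha>\<close> show "AE x in M. real_cond_exp M (F n) (indicator A) x \<le> \<alpha> \<longrightarrow>
           weighted_cond_exp M w (F n) (indicator A) x \<le> \<beta>"
        by (rule *) (use L in blast)
    qed
  next
    assume R: ?R
    show ?L
    proof (intro allI ballI impI)
      fix n A assume A: "A \<in> sets M"
        and "AE x in M. real_cond_exp M (F n) (indicator A) x \<le> \<alpha>"
      from R[rule_format, OF A, of n] this(2)
      show "AE x in M. weighted_cond_exp M w (F n) (indicator A) x \<le> \<beta>"
        by eventually_elim auto
    qed
  qed
  note eq = this
  show ?thesis
    unfolding A_infinity_M_def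
    by (intro ex_cong1 conj_cong refl) (rule eq)
qed

end

theory Submission
  imports Defs
begin

text \<open>
  Write \<open>\<omega>\<^sub>n = E(\<omega> | F\<^sub>n)\<close>, and call the set where \<open>\<omega> \<le> \<gamma> \<omega>\<^sub>n\<close> the sublevel set. Each
  \<open>F\<^sub>n\<close> can be treated separately, as the constants obtained for one condition depend only on
  those of the other. Since \<open>\<omega>\<^sub>n\<close> is \<open>F\<^sub>n\<close>-measurable, it may be pulled
  out of a conditional expectation, so that a bound of \<open>\<omega>\<close> by \<open>\<gamma> \<omega>\<^sub>n\<close> on a set \<open>C\<close>, in either
  direction, becomes the same bound of \<open>E\<^sub>\<omega>(C | F\<^sub>n)\<close> by \<open>\<gamma> E(C | F\<^sub>n)\<close>
  (\<open>weighted_cond_exp_indicator_le\<close> and \<open>weighted_cond_exp_indicator_ge\<close>).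

  Let the sublevel set \<open>B\<close> have conditional probability at most \<open>\<delta>\<close>, and let \<open>E(A | F\<^sub>n) \<le> \<alpha>\<close> with
  \<open>\<alpha> + \<delta> < 1\<close>. Then the complement of \<open>A \<union> B\<close> keeps conditional probability at least
  \<open>1 - \<alpha> - \<delta>\<close>, and there \<open>\<omega>\<close> exceeds \<open>\<gamma> \<omega>\<^sub>n\<close>. Hence the weighted probability outside \<open>A\<close> is at
  least \<open>\<gamma> (1 - \<alpha> - \<delta>)\<close>, which keeps that of \<open>A\<close> away from \<open>1\<close>.

  Conversely, the sublevel set always has weighted probability at most \<open>\<gamma>\<close>, so its complement has
  weighted probability at least \<open>1 - \<gamma>\<close>. If \<open>1 - \<gamma> > \<beta>\<close>, the contrapositive of the second
  condition, read pointwise (\<open>A_infinity_M_iff_pointwise\<close>), shows that this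
  complement has conditional probability above \<open>\<alpha>\<close>, and so the sublevel set has conditional probability below \<open>1 - \<alpha>\<close>.
\<close>

section \<open>Conditional probabilities in a finite measure\<close>

lemma (in finite_measure) integrable_indicator:
  assumes "A \<in> sets M"
  shows "integrable M (indicator A :: 'a \<Rightarrow> real)"
  using assms by (auto intro!: integrable_real_indicator simp: less_top[symmetric])

context finite_measure_subalgebra
begin

lemma cond_exp_indicator_compl:
  assumes "A \<in> sets M"
  shows "AE x in M. real_cond_exp M F (indicator (space M - A)) x =
    1 - real_cond_exp M F (indicator A) x"
proof -
  note int = integrable_indicator[OF assms]
  have "AE x in M. real_cond_exp M F (indicator (space M - A)) x =
      real_cond_exp M F (\<lambda>x. 1 - indicator A x) x"
    by (rule real_cond_exp_cong) (use assms in \<open>auto intro!: AE_I2 simp: indicator_def\<close>)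
  moreover have "AE x in M. real_cond_exp M F (\<lambda>x. 1 - indicator A x) x =
      real_cond_exp M F (\<lambda>x. 1) x - real_cond_exp M F (indicator A) x"
    by (rule real_cond_exp_diff) (use int in auto)
  moreover have "AE x in M. real_cond_exp M F (\<lambda>x. 1) x = 1"
    by (rule real_cond_exp_F_meas) auto
  ultimately show ?thesis by eventually_elim simp
qed

lemma cond_exp_indicator_mono:
  assumes "A \<in> sets M" "B \<in> sets M" "A \<subseteq> B"
  shows "AE x in M. real_cond_exp M F (indicator A) x \<le> real_cond_exp M F (indicator B) x"
  by (rule real_cond_exp_mono)
    (use assms in \<open>auto intro!: AE_I2 integrable_indicator simp: indicator_def\<close>)

lemma cond_exp_indicator_subadditive:
  assumes "A \<in> sets M" "B \<in> sets M" "C \<in> sets M" "A \<subseteq> B \<union> C"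
  shows "AE x in M. real_cond_exp M F (indicator A) x \<le>
    real_cond_exp M F (indicator B) x + real_cond_exp M F (indicator C) x"
proof -
  have "AE x in M. real_cond_exp M F (indicator A) x \<le>
      real_cond_exp M F (\<lambda>x. indicator B x + indicator C x) x"
  proof (rule real_cond_exp_mono)
    show "AE x in M. indicator A x \<le> (indicator B x + indicator C x :: real)"
      using assms(4) by (auto intro!: AE_I2 simp: indicator_def)
  qed (use assms in \<open>auto intro!: Bochner_Integration.integrable_add integrable_indicator\<close>)
  moreover have "AE x in M. real_cond_exp M F (\<lambda>x. indicator B x + indicator C x) x =
      real_cond_exp M F (indicator B) x + real_cond_exp M F (indicator C) x"
    by (rule real_cond_exp_add) (use assms in \<open>auto intro: integrable_indicator\<close>)
  ultimately show ?thesis by eventually_elim simp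
qed

end

section \<open>Weighted conditional probabilities\<close>

lemma weighted_cond_exp_indicator_compl:
  assumes "weight M w" "subalgebra M G" "A \<in> sets M"
  shows "AE x in M. weighted_cond_exp M w G (indicator (space M - A)) x =
    1 - weighted_cond_exp M w G (indicator A) x"
proof -
  interpret N: finite_measure_subalgebra "density M (\<lambda>x. ennreal (w x))" G
    by (rule finite_measure_subalgebra_density_weight) fact+
  show ?thesis
    using N.cond_exp_indicator_compl[of A] assms(3)
    by (simp add: AE_density_weight[OF assms(1)] weighted_cond_exp_def)
qed

lemma weighted_cond_exp_indicator_mono:
  assumes "weight M w" "subalgebra M G" "A \<in> sets M" "B \<in> sets M" "A \<subseteq> B"
  shows "AE x in M. weighted_cond_exp M w G (indicator A) x \<le>
    weighted_cond_exp M w G (indicator B) x"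
proof -
  interpret N: finite_measure_subalgebra "density M (\<lambda>x. ennreal (w x))" G
    by (rule finite_measure_subalgebra_density_weight) fact+
  show ?thesis
    using N.cond_exp_indicator_mono[of A B] assms(3-5)
    by (simp add: AE_density_weight[OF assms(1)] weighted_cond_exp_def)
qed

text \<open>The two comparison lemmas below follow by integrating a pointwise bound of \<open>w\<close> over \<open>C\<close>
  conditionally on \<open>G\<close> and dividing by \<open>E(w | G)\<close>. These facts justify the two steps: the
  \<open>G\<close>-measurable factor \<open>c E(w | G)\<close> comes out of the conditional expectation, and the
  denominator is positive.\<close>

lemma weighted_cond_exp_indicator_facts:
  fixes c :: real
  assumes "prob_space M" "weight M w" "subalgebra M G" "C \<in> sets M"
  shows "AE x in M. weighted_cond_exp M w G (indicator C) x =
      real_cond_exp M G (\<lambda>y. indicator C y * w y) x / real_cond_exp M G w x"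
    and "AE x in M. 0 < real_cond_exp M G w x"
    and "AE x in M. real_cond_exp M G (\<lambda>y. c * real_cond_exp M G w y * indicator C y) x =
      c * real_cond_exp M G w x * real_cond_exp M G (indicator C) x"
    and "integrable M (\<lambda>y. indicator C y * w y)"
    and "integrable M (\<lambda>y. c * real_cond_exp M G w y * indicator C y)"
proof -
  interpret prob_space M by fact
  interpret finite_measure_subalgebra M G
    by standard fact
  have int: "integrable M w" and pos: "AE x in M. 0 < w x"
    using assms by (auto simp: weight_def)
  show intw: "integrable M (\<lambda>y. indicator C y * w y)"
    using integrable_mult_indicator[OF assms(4) int] by simp
  have "integrable M (\<lambda>y. c * real_cond_exp M G w y)"
    using real_cond_exp_int(1)[OF int] by simp
  from integrable_mult_indicator[OF assms(4) this]
  show intc: "integrable M (\<lambda>y. c * real_cond_exp M G w y * indicator C y)"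
    by (simp add: mult.commute)
  show "AE x in M. weighted_cond_exp M w G (indicator C) x =
      real_cond_exp M G (\<lambda>y. indicator C y * w y) x / real_cond_exp M G w x"
    by (rule weighted_cond_exp_eq) (use assms intw in auto)
  show "AE x in M. 0 < real_cond_exp M G w x"
    by (rule real_cond_exp_gr_c[OF int pos])
  show "AE x in M. real_cond_exp M G (\<lambda>y. c * real_cond_exp M G w y * indicator C y) x =
      c * real_cond_exp M G w x * real_cond_exp M G (indicator C) x"
    by (rule real_cond_exp_mult) (use intc assms(4) in auto)
qed

lemma weighted_cond_exp_indicator_le:
  fixes c :: real
  assumes "prob_space M" "weight M w" "subalgebra M G" "C \<in> sets M"
    and le: "\<And>x. x \<in> C \<Longrightarrow> w x \<le> c * real_cond_exp M G w x"
  shows "AE x in M. weighted_cond_exp M w G (indicator C) x \<le>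
    c * real_cond_exp M G (indicator C) x"
proof -
  interpret prob_space M by fact
  interpret finite_measure_subalgebra M G
    by standard fact
  note facts = weighted_cond_exp_indicator_facts[OF assms(1-4)]
  have "AE x in M. real_cond_exp M G (\<lambda>y. indicator C y * w y) x \<le>
      real_cond_exp M G (\<lambda>y. c * real_cond_exp M G w y * indicator C y) x"
    by (rule real_cond_exp_mono[OF _ facts(4,5)])
      (auto intro!: AE_I2 simp: indicator_def le)
  with facts(1,2) facts(3)[of c] show ?thesis
    by eventually_elim (simp add: pos_divide_le_eq mult_ac)
qed

lemma weighted_cond_exp_indicator_ge:
  fixes c :: real
  assumes "prob_space M" "weight M w" "subalgebra M G" "C \<in> sets M"
    and ge: "\<And>x. x \<in> C \<Longrightarrow> c * real_cond_exp M G w x \<le> w x"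
  shows "AE x in M. c * real_cond_exp M G (indicator C) x \<le>
    weighted_cond_exp M w G (indicator C) x"
proof -
  interpret prob_space M by fact
  interpret finite_measure_subalgebra M G
    by standard fact
  note facts = weighted_cond_exp_indicator_facts[OF assms(1-4)]
  have "AE x in M. real_cond_exp M G (\<lambda>y. c * real_cond_exp M G w y * indicator C y) x \<le>
      real_cond_exp M G (\<lambda>y. indicator C y * w y) x"
    by (rule real_cond_exp_mono[OF _ facts(5,4)])
      (auto intro!: AE_I2 simp: indicator_def ge)
  with facts(1,2) facts(3)[of c] show ?thesis
    by eventually_elim (simp add: pos_le_divide_eq mult_ac)
qed

section \<open>The sublevel set of the weight\<close>

definition weight_sublevel :: "'a measure \<Rightarrow> 'a measure \<Rightarrow> ('a \<Rightarrow> real) \<Rightarrow> real \<Rightarrow> 'a set" where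
  "weight_sublevel M G w c = {y \<in> space M. w y \<le> c * real_cond_exp M G w y}"

lemma sets_weight_sublevel:
  assumes "weight M w"
  shows "weight_sublevel M G w c \<in> sets M"
proof -
  have [measurable]: "w \<in> borel_measurable M" using assms by (auto simp: weight_def)
  show ?thesis unfolding weight_sublevel_def by measurable
qed

lemma weighted_cond_exp_sublevel_le:
  assumes "prob_space M" "weight M w" "subalgebra M G" "0 \<le> c"
  shows "AE x in M. weighted_cond_exp M w G (indicator (weight_sublevel M G w c)) x \<le> c"
proof -
  interpret prob_space M by fact
  interpret finite_measure_subalgebra M G
    by standard fact
  let ?B = "weight_sublevel M G w c"
  have B: "?B \<in> sets M" using assms(2) by (rule sets_weight_sublevel)
  have "AE x in M. real_cond_exp M G (indicator ?B) x \<le> 1"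
    by (rule real_cond_exp_le_c)
      (use B in \<open>auto intro!: AE_I2 integrable_indicator simp: indicator_def\<close>)
  moreover have "AE x in M. weighted_cond_exp M w G (indicator ?B) x \<le>
      c * real_cond_exp M G (indicator ?B) x"
    by (rule weighted_cond_exp_indicator_le[OF assms(1-3) B]) (simp add: weight_sublevel_def)
  ultimately show ?thesis
    by eventually_elim (use assms(4) mult_left_le in fastforce)
qed

text \<open>Off \<open>A\<close> and off the sublevel set the weight exceeds \<open>c E(w | G)\<close>, and by subadditivity this
  part of the space has conditional probability at least \<open>1 - E(A | G) - E(B | G)\<close>, where \<open>B\<close> is
  the sublevel set. Its weighted probability is lost to \<open>A\<close>.\<close>

lemma weighted_cond_exp_indicator_le_sublevel:
  assumes "prob_space M" "weight M w" "subalgebra M G" "0 \<le> c" and A: "A \<in> sets M"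
  shows "AE x in M. weighted_cond_exp M w G (indicator A) x \<le>
    1 - c * (1 - real_cond_exp M G (indicator A) x
               - real_cond_exp M G (indicator (weight_sublevel M G w c)) x)"
proof -
  interpret prob_space M by fact
  interpret finite_measure_subalgebra M G
    by standard fact
  define B where "B = weight_sublevel M G w c"
  define C where "C = space M - A - B"
  have B: "B \<in> sets M" unfolding B_def using assms(2) by (rule sets_weight_sublevel)
  have C: "C \<in> sets M" unfolding C_def using A B by auto
  have "AE x in M. real_cond_exp M G (indicator (space M - A)) x \<le>
      real_cond_exp M G (indicator B) x + real_cond_exp M G (indicator C) x"
    by (rule cond_exp_indicator_subadditive) (use A B C in \<open>auto simp: C_def\<close>)
  moreover have "AE x in M. c * real_cond_exp M G (indicator C) x \<le>
      weighted_cond_exp M w G (indicator C) x"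
    by (rule weighted_cond_exp_indicator_ge[OF assms(1-3) C])
      (auto simp: C_def B_def weight_sublevel_def)
  moreover have "AE x in M. weighted_cond_exp M w G (indicator C) x \<le>
      weighted_cond_exp M w G (indicator (space M - A)) x"
    by (rule weighted_cond_exp_indicator_mono) (use assms C in \<open>auto simp: C_def\<close>)
  moreover note cond_exp_indicator_compl[OF A]
    weighted_cond_exp_indicator_compl[OF assms(2,3) A]
  ultimately have "AE x in M. weighted_cond_exp M w G (indicator A) x \<le>
      1 - c * (1 - real_cond_exp M G (indicator A) x - real_cond_exp M G (indicator B) x)"
  proof eventually_elim
    case (elim x)
    have "c * (1 - real_cond_exp M G (indicator A) x - real_cond_exp M G (indicator B) x) \<le>
        c * real_cond_exp M G (indicator C) x"
      by (rule mult_left_mono) (use elim assms(4) in auto)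
    with elim show ?case by linarith
  qed
  then show ?thesis by (simp add: B_def)
qed

section \<open>The equivalence\<close>

lemma A_infinity_con_imp_M:
  assumes "prob_space M" "weight M w" "\<And>n. subalgebra M (F n)" "A_infinity_con M F w"
  shows "A_infinity_M M F w"
proof -
  from assms(4) obtain \<gamma> \<delta> where c: "0 < \<gamma>" "\<gamma> < 1" "0 < \<delta>" "\<delta> < 1"
    and con: "\<And>n. AE x in M.
      real_cond_exp M (F n) (indicator (weight_sublevel M (F n) w \<gamma>)) x \<le> \<delta>"
    unfolding A_infinity_con_def weight_sublevel_def by blast
  \<comment> \<open>Any positive \<open>\<alpha>\<close> below \<open>1 - \<delta>\<close> would serve; it has to leave \<open>1 - \<alpha> - \<delta>\<close> positive.\<close>
  define \<alpha> where "\<alpha> = (1 - \<delta>) / 2"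
  define \<beta> where "\<beta> = 1 - \<gamma> * (1 - \<alpha> - \<delta>)"
  have pos: "0 < 1 - \<alpha> - \<delta>" "1 - \<alpha> - \<delta> < 1" using c by (auto simp: \<alpha>_def field_simps)
  have "\<gamma> * (1 - \<alpha> - \<delta>) < 1 * 1"
    by (rule mult_strict_mono) (use c pos in auto)
  moreover have "0 < \<gamma> * (1 - \<alpha> - \<delta>)" using c pos by simp
  ultimately have \<beta>: "0 < \<beta>" "\<beta> < 1" by (auto simp: \<beta>_def)
  have "AE x in M. weighted_cond_exp M w (F n) (indicator A) x \<le> \<beta>"
    if A: "A \<in> sets M" and le: "AE x in M. real_cond_exp M (F n) (indicator A) x \<le> \<alpha>" for n A
    using weighted_cond_exp_indicator_le_sublevel[OF assms(1,2) assms(3)[of n] less_imp_le[OF c(1)] A]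
      le con[of n]
  proof eventually_elim
    case (elim x)
    have "\<gamma> * (1 - \<alpha> - \<delta>) \<le> \<gamma> * (1 - real_cond_exp M (F n) (indicator A) x
        - real_cond_exp M (F n) (indicator (weight_sublevel M (F n) w \<gamma>)) x)"
      by (rule mult_left_mono) (use elim c in auto)
    with elim show ?case by (simp add: \<beta>_def)
  qed
  moreover have "0 < \<alpha>" "\<alpha> < 1" using c by (auto simp: \<alpha>_def)
  ultimately show ?thesis
    unfolding A_infinity_M_def using \<beta> by blast
qed

lemma A_infinity_M_imp_con:
  assumes "prob_space M" "weight M w" "\<And>n. subalgebra M (F n)" "A_infinity_M M F w"
  shows "A_infinity_con M F w"
proof -
  interpret prob_space M by fact
  from assms(4) obtain \<alpha> \<beta> where c: "0 < \<alpha>" "\<alpha> < 1" "0 < \<beta>" "\<beta> < 1"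
    and imp: "\<And>n A. A \<in> sets M \<Longrightarrow> AE x in M.
      real_cond_exp M (F n) (indicator A) x \<le> \<alpha> \<longrightarrow>
      weighted_cond_exp M w (F n) (indicator A) x \<le> \<beta>"
    unfolding A_infinity_M_iff_pointwise[OF assms(1-3)] by blast
  \<comment> \<open>This makes \<open>1 - \<gamma> > \<beta>\<close>, so that the complement of the sublevel set violates the bound \<open>\<beta>\<close>
    almost everywhere.\<close>
  define \<gamma> where "\<gamma> = (1 - \<beta>) / 2"
  have \<gamma>: "0 < \<gamma>" "\<gamma> < 1" "\<beta> < 1 - \<gamma>" using c by (auto simp: \<gamma>_def field_simps)
  have "AE x in M. real_cond_exp M (F n) (indicator (weight_sublevel M (F n) w \<gamma>)) x \<le> 1 - \<alpha>"
    for n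
  proof -
    interpret finite_measure_subalgebra M "F n"
      by standard fact
    let ?B = "weight_sublevel M (F n) w \<gamma>"
    have B: "?B \<in> sets M" using assms(2) by (rule sets_weight_sublevel)
    have "AE x in M. weighted_cond_exp M w (F n) (indicator ?B) x \<le> \<gamma>"
      by (rule weighted_cond_exp_sublevel_le) (use assms \<gamma> in auto)
    moreover note weighted_cond_exp_indicator_compl[OF assms(2) assms(3)[of n] B]
      cond_exp_indicator_compl[OF B]
      imp[OF sets.compl_sets[OF B], of n]
    ultimately show ?thesis
      by eventually_elim (use \<gamma> in linarith)
  qed
  then show ?thesis
    unfolding A_infinity_con_def weight_sublevel_def
    using \<gamma>(1,2) c(1,2) by (intro exI[of _ \<gamma>] exI[of _ "1 - \<alpha>"]) auto
qed

theorem theorem1p4: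
  fixes M :: "'a measure" and F :: "nat \<Rightarrow> 'a measure" and \<omega> :: "'a \<Rightarrow> real"
  assumes "prob_space M" and "complete_measure M"
    and "filtration (space M) F"
    and "\<And>n. subalgebra M (F n)"
    and "sets M = sigma_sets (space M) (\<Union>n. sets (F n))"
    and "weight M \<omega>"
  shows "A_infinity_con M F \<omega> \<longleftrightarrow> A_infinity_M M F \<omega>"
  using A_infinity_con_imp_M[of M \<omega> F, OF assms(1,6,4)]
    A_infinity_M_imp_con[of M \<omega> F, OF assms(1,6,4)]
  by blast

end
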